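(* For all $n\ge1$ and $\mathbf a=(a_1,\dots,a_n)\in\mathbb N^n$ with $a_1\neq0$, the primitive $f$-polynomial of $\mathrm{Flow}_n(\mathbf a)$ is $$\widetilde f^{(n)}(\mathbf a;x)=\frac1{x^n}\sum_{\operatorname{supp}(\mathbf a')\subseteq S\subseteq[n-1]}(-1)^{|S|+n+1}\prod_{j\in[n]}\Big((x+1)^{\operatorname{seq}_{n-1}(S)_j}-1\Big),$$ where $\mathbf a'=(a_2,\dots,a_n)$, $\operatorname{supp}(\mathbf a')=\{j\in[n-1]:a_{j+1}\ne0\}$, and $\operatorname{seq}_{n-1}(S)_j=1+\#\{s\in S: s\ge j\}$ for $j\in[n]$.
   Context: $\mathbb N=\{0,1,2,\dots\}$, $[n]=\{1,\dots,n\}$. $K_{n+1}$ is the directed graph on $v_1,\dots,v_{n+1}$ with one edge $(v_i,v_j)$ for each $1\le i<j\le n+1$. For $\mathbf a\in\mathbb N^n$, an $\mathbf a$-flow is a function $f:E(K_{n+1})\to\mathbb R_{\ge0}$ with $\sum_{j>i}f(v_i,v_j)-\sum_{k<i}f(v_k,v_i)=a_i$ for all $i\in[n]$. $\mathrm{Flow}_n(\mathbf a)$ is the polytope of all $\mathbf a$-flows. A subgraph $H\subseteq K_{n+1}$ is $\mathbf a$-valid if its edge set is the support $\{e:f(e)>0\}$ of some $\mathbf a$-flow (its vertex set being the set of endpoints of these edges). $H$ is primitive if it is connected (as an undirected graph) and $V(H)=\{v_1,\dots,v_{n+1}\}$. The first Betti number is $\beta_1(H)=|E(H)|-|V(H)|+c(H)$,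 with $c(H)$ the number of connected components. The primitive $f$-polynomial of $\mathrm{Flow}_n(\mathbf a)$ is $\widetilde f^{(n)}(\mathbf a;x)=\sum_H x^{\beta_1(H)}$, the sum over all $\mathbf a$-valid primitive subgraphs $H$ of $K_{n+1}$. *)

theory Defs
  imports
    Graph_Theory.Digraph_Component
    Complex_Main
    "HOL-Library.FuncSet"
    "HOL-Computational_Algebra.Polynomial"
    "HOL-Computational_Algebra.Fraction_Field"
begin

text \<open>The vertex \<open>v\<^sub>i\<close> is represented by the natural number \<open>i \<ge> 1\<close>, and a vector
  \<open>(a\<^sub>1, \<dots>, a\<^sub>n)\<close> by a function on \<open>nat\<close> of which only the values at \<open>1, \<dots>, n\<close> are used.\<close>

definition complete_dag :: "nat \<Rightarrow> nat pair_pre_digraph" where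
  "complete_dag m =
     \<lparr> pverts = {1..m}, parcs = {(i, j). 1 \<le> i \<and> i < j \<and> j \<le> m} \<rparr>"

text \<open>Flows are functions on the edge set only, hence the extensional function space.\<close>

definition flow_polytope :: "nat \<Rightarrow> (nat \<Rightarrow> nat) \<Rightarrow> (nat \<times> nat \<Rightarrow> real) set" where
  "flow_polytope n a =
     {f \<in> parcs (complete_dag (n + 1)) \<rightarrow>\<^sub>E {0..}.
        \<forall>i\<in>{1..n}. (\<Sum>j\<in>{i<..n + 1}. f (i, j)) - (\<Sum>k\<in>{1..<i}. f (k, i)) = real (a i)}"

definition valid_subgraph :: "nat \<Rightarrow> (nat \<Rightarrow> nat) \<Rightarrow> nat pair_pre_digraph \<Rightarrow> bool" where
  "valid_subgraph n a H \<longleftrightarrow>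
     subgraph (with_proj H) (with_proj (complete_dag (n + 1))) \<and>
     (\<exists>f\<in>flow_polytope n a. parcs H = {e \<in> parcs (complete_dag (n + 1)). f e > 0}) \<and>
     pverts H = Field (parcs H)"

text \<open>\<^const>\<open>Digraph_Component.connected\<close> is connectedness of the underlying undirected graph; the
  qualifier distinguishes it from topological connectedness.\<close>

definition primitive :: "nat \<Rightarrow> nat pair_pre_digraph \<Rightarrow> bool" where
  "primitive n H \<longleftrightarrow> Digraph_Component.connected (with_proj H) \<and> pverts H = {1..n + 1}"

text \<open>The connected components of the underlying undirected graph are the strongly connected
  components of its symmetrization.\<close>

definition num_components :: "nat pair_pre_digraph \<Rightarrow> nat" where
  "num_components H = card (pre_digraph.sccs (with_proj (mk_symmetric (with_proj H))))"

text \<open>For a finite graph \<open>|V| \<le> |E| + c\<close>, so the subtraction on \<open>nat\<close> does not truncate.\<close>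

definition betti1 :: "nat pair_pre_digraph \<Rightarrow> nat" where
  "betti1 H = card (parcs H) + num_components H - card (pverts H)"

definition primitive_f_poly :: "nat \<Rightarrow> (nat \<Rightarrow> nat) \<Rightarrow> int poly" where
  "primitive_f_poly n a = (\<Sum>H | valid_subgraph n a H \<and> primitive n H. monom 1 (betti1 H))"

definition supp :: "nat \<Rightarrow> (nat \<Rightarrow> nat) \<Rightarrow> nat set" where
  "supp m b = {j \<in> {1..m}. b j \<noteq> 0}"

text \<open>For \<open>S \<subseteq> {1..m}\<close> the sequence does not depend on \<open>m\<close>, except for its length \<open>m + 1\<close>.\<close>

definition seq :: "nat set \<Rightarrow> nat \<Rightarrow> nat" where
  "seq S j = 1 + card {s \<in> S. s \<ge> j}"

end

theory Submission
  imports Defs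
begin

text \<open>A spanning graph is \<open>a\<close>-valid iff every \<open>v\<^sub>i\<close> with \<open>i \<le> n\<close> has an outgoing edge and every
  \<open>v\<^sub>i\<close> with \<open>2 \<le> i \<le> n\<close> and \<open>a\<^sub>i = 0\<close> has an incoming one: necessity is conservation of flow, and
  for sufficiency each vertex splits what it receives evenly among its outgoing edges, starting from
  \<open>a\<^sub>1 > 0\<close>. Such a graph is connected, since following outgoing edges leads to \<open>v\<^sub>n\<^sub>+\<^sub>1\<close>, so its Betti
  number is \<open>|E| - n\<close>. The condition on incoming edges is removed by inclusion-exclusion: \<open>S\<close> collects
  the (shifted) inner vertices that may receive edges. Then \<open>v\<^sub>j\<close> chooses an arbitrary nonempty subset
  of its \<open>seq S j\<close> permitted targets, independently for each \<open>j\<close>, which gives the product.\<close>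

section \<open>Generating functions and signed sums over subsets\<close>

lemma sum_Pow_power_card:
  fixes x :: "'a::comm_semiring_1"
  assumes "finite A"
  shows "(\<Sum>X\<in>Pow A. x ^ card X) = (x + 1) ^ card A"
  using prod_add[OF assms, of "\<lambda>_. x" "\<lambda>_. 1"] by simp

lemma sum_nonempty_subsets_power_card:
  fixes x :: "'a::comm_ring_1"
  assumes "finite A"
  shows "(\<Sum>X\<in>Pow A - {{}}. x ^ card X) = (x + 1) ^ card A - 1"
  using assms by (simp add: sum_diff sum_Pow_power_card)

text \<open>Writing \<open>S = A \<union> X\<close> with \<open>X \<subseteq> B - A\<close> turns
  the sum into a multiple of \<open>(1 - 1) ^ card (B - A)\<close>, which survives only if the
  interval is a point. The summand \<open>card B\<close> in the exponent makes the surviving sign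
  positive.\<close>

lemma sum_interval_alternating:
  fixes A B :: "'b set"
  assumes "finite B" "A \<subseteq> B"
  shows "(\<Sum>S | A \<subseteq> S \<and> S \<subseteq> B. (- 1) ^ (card S + card B)) = (if A = B then 1 else (0::'a::comm_ring_1))"
proof -
  have fA: "finite A" using assms finite_subset by blast
  have "(\<Sum>S | A \<subseteq> S \<and> S \<subseteq> B. (- 1 :: 'a) ^ (card S + card B))
      = (\<Sum>X\<in>Pow (B - A). (- 1) ^ card X * (- 1) ^ (card A + card B))"
  proof (rule sum.reindex_bij_witness[where i = "\<lambda>X. A \<union> X" and j = "\<lambda>S. S - A"])
    fix S assume S: "S \<in> {S. A \<subseteq> S \<and> S \<subseteq> B}"
    then have "card S = card A + card (S - A)"
      using fA by (metis (no_types, lifting) assms(1) card_mono card_Diff_subset finite_subset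
          le_add_diff_inverse mem_Collect_eq)
    then show "(- 1 :: 'a) ^ card (S - A) * (- 1) ^ (card A + card B) = (- 1) ^ (card S + card B)"
      by (simp add: power_add mult_ac)
  qed (use assms in auto)
  also have "\<dots> = 0 ^ card (B - A) * (- 1) ^ (card A + card B)"
    using assms sum_Pow_power_card[of "B - A" "- 1 :: 'a"] by (simp flip: sum_distrib_right)
  also have "\<dots> = (if A = B then 1 else 0)"
    using assms by (auto simp: power_0_left)
  finally show ?thesis .
qed

section \<open>Counting components\<close>

text \<open>\<open>G\<close> itself is a candidate, so maximality forces a strong component to
  contain all vertices, and being induced it then has all arcs.\<close>

lemma sccs_strongly_connected:
  assumes "wf_digraph G" "strongly_connected G"
  shows "pre_digraph.sccs G = {G}"
proof -
  interpret wf_digraph G by fact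
  have ind: "induced_subgraph G G"
    using assms(1) by (auto simp: induced_subgraph_def subgraph_def compatible_def)
  show ?thesis
  proof (intro equalityI subsetI)
    fix H assume H: "H \<in> sccs"
    then have sub: "subgraph H G" and verts: "verts H = verts G"
      using ind assms(2) by (auto simp: sccs_def induced_subgraph_def subgraph_def)
    moreover have "arcs H = arcs G"
      using H verts by (auto simp: sccs_def induced_subgraph_def)
    ultimately show "H \<in> {G}"
      by (auto simp: subgraph_def compatible_def intro: pre_digraph.equality)
  qed (use ind assms(2) in \<open>auto simp: sccs_def induced_subgraph_def dest: subgraph_imp_subverts\<close>)
qed

text \<open>Connectedness is by definition strong connectedness of the symmetrization, whose strong
  components are the ones counted.\<close>

lemma num_components_connected:
  assumes "wf_digraph (with_proj H)" "Digraph_Component.connected (with_proj H)"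
  shows "num_components H = 1"
proof -
  interpret pair_wf_digraph "mk_symmetric (with_proj H)"
    using assms(1) by (rule wf_digraph.wellformed_mk_symmetric)
  have "wf_digraph (with_proj (mk_symmetric (with_proj H)))" ..
  then show ?thesis
    using assms(2) sccs_strongly_connected
    unfolding num_components_def connected_def by fastforce
qed

section \<open>Spanning graphs, their connectedness and Betti numbers\<close>

text \<open>A graph is encoded by the family of the out-neighbourhoods of \<open>v\<^sub>1, \<dots>, v\<^sub>n\<close>.\<close>

definition out_families :: "nat \<Rightarrow> (nat \<Rightarrow> nat set) set" where
  "out_families n = (\<Pi>\<^sub>E i\<in>{1..n}. Pow {i<..n + 1} - {{}})"

definition family_graph :: "nat \<Rightarrow> (nat \<Rightarrow> nat set) \<Rightarrow> nat pair_pre_digraph" where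
  "family_graph n F = \<lparr> pverts = {1..n + 1}, parcs = Sigma {1..n} F \<rparr>"

text \<open>Shifted as in \<^const>\<open>supp\<close>: the index \<open>s\<close> stands for the vertex \<open>v\<^sub>s\<^sub>+\<^sub>1\<close>.\<close>

definition hit :: "nat \<Rightarrow> (nat \<Rightarrow> nat set) \<Rightarrow> nat set" where
  "hit n F = {s \<in> {1..n - 1}. \<exists>j\<in>{1..n}. Suc s \<in> F j}"

lemma out_familiesD:
  assumes "F \<in> out_families n" "i \<in> {1..n}"
  shows "F i \<subseteq> {i<..n + 1}" "F i \<noteq> {}" "finite (F i)"
proof -
  have "F i \<in> Pow {i<..n + 1} - {{}}"
    using assms unfolding out_families_def by (rule PiE_mem)
  then show "F i \<subseteq> {i<..n + 1}" "F i \<noteq> {}" "finite (F i)"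
    by (auto intro: finite_subset)
qed

lemma finite_out_families: "finite (out_families n)"
  unfolding out_families_def by (intro finite_PiE) auto

lemma wf_family_graph:
  assumes "F \<in> out_families n"
  shows "wf_digraph (with_proj (family_graph n F))"
  using out_familiesD(1)[OF assms] by unfold_locales (fastforce simp: family_graph_def)+

text \<open>Arcs lead to larger indices and every vertex up to \<open>n\<close> has one, so each
  step shortens the distance \<open>n + 1 - u\<close>.\<close>

lemma family_graph_reaches_sink:
  assumes F: "F \<in> out_families n" and "u \<in> {1..n + 1}"
  shows "u \<rightarrow>\<^sup>*\<^bsub>with_proj (family_graph n F)\<^esub> (n + 1)"
  using assms(2)
proof (induction "n + 1 - u" arbitrary: u rule: less_induct)
  case less
  interpret wf_digraph "with_proj (family_graph n F)" using F by (rule wf_family_graph)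
  show ?case
  proof (cases "u = n + 1")
    case True
    then show ?thesis using reachable_refl[of "n + 1"] by (simp add: family_graph_def)
  next
    case False
    then have u: "u \<in> {1..n}" using less.prems by auto
    then obtain v where v: "v \<in> F u" "u < v" "v \<le> n + 1"
      using out_familiesD[OF F u] by fastforce
    have "v \<rightarrow>\<^sup>*\<^bsub>with_proj (family_graph n F)\<^esub> (n + 1)"
      using v u by (intro less.hyps) auto
    moreover have "(u, v) \<in> arcs_ends (with_proj (family_graph n F))"
      using u v by (simp add: family_graph_def)
    ultimately show ?thesis by (rule adj_reachable_trans[rotated])
  qed
qed

lemma connected_family_graph:
  assumes F: "F \<in> out_families n"
  shows "Digraph_Component.connected (with_proj (family_graph n F))"
proof -
  let ?G = "with_proj (family_graph n F)"
  let ?M = "with_proj (mk_symmetric ?G)"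
  interpret wf_digraph ?G using F by (rule wf_family_graph)
  interpret M: pair_wf_digraph "mk_symmetric ?G" ..
  have to_sink: "u \<rightarrow>\<^sup>*\<^bsub>?M\<^esub> (n + 1)" if "u \<in> {1..n + 1}" for u
    using family_graph_reaches_sink[OF F that] by (rule reachable_mk_symmetricI)
  have "u \<rightarrow>\<^sup>*\<^bsub>?M\<^esub> v" if "u \<in> {1..n + 1}" "v \<in> {1..n + 1}" for u v
    using to_sink[OF that(1)] symmetric_reachable[OF symmetric_mk_symmetric to_sink[OF that(2)]]
    by (rule M.reachable_trans)
  then show ?thesis
    unfolding connected_def by (intro strongly_connectedI) (auto simp: family_graph_def)
qed

lemma betti1_family_graph:
  assumes F: "F \<in> out_families n"
  shows "betti1 (family_graph n F) + n = (\<Sum>i\<in>{1..n}. card (F i))"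
proof -
  have "card (Sigma {1..n} F) = (\<Sum>i\<in>{1..n}. card (F i))"
    using out_familiesD[OF F] by (intro card_SigmaI) auto
  \<comment> \<open>Nonempty out-neighbourhoods give at least \<open>n\<close> arcs, so the
    subtraction on \<open>nat\<close> in \<open>betti1\<close> is exact.\<close>
  moreover have "(\<Sum>i\<in>{1..n}. 1) \<le> (\<Sum>i\<in>{1..n}. card (F i))"
    using out_familiesD[OF F] by (intro sum_mono) (auto simp: Suc_le_eq card_gt_0_iff)
  ultimately show ?thesis
    using num_components_connected[OF wf_family_graph[OF F] connected_family_graph[OF F]]
    by (simp add: betti1_def) (simp add: family_graph_def)
qed

section \<open>Flows and validity\<close>

text \<open>The amount leaving \<open>v\<^sub>i\<close> when each vertex splits its supply and inflow evenly among its
  out-neighbours.\<close>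

fun throughput :: "(nat \<Rightarrow> nat) \<Rightarrow> (nat \<Rightarrow> nat set) \<Rightarrow> nat \<Rightarrow> real" where
  "throughput a F i = real (a i) +
     (\<Sum>k\<in>{1..<i}. if i \<in> F k then throughput a F k / real (card (F k)) else 0)"

declare throughput.simps [simp del]

lemma throughput_nonneg: "throughput a F i \<ge> 0"
proof (induction i rule: less_induct)
  case (less i)
  then show ?case
    by (subst throughput.simps) (auto intro!: add_nonneg_nonneg sum_nonneg)
qed

text \<open>A vertex without supply has an in-neighbour, which has a smaller index and, by
  induction, sends on a positive share.\<close>

lemma throughput_pos:
  assumes "a 1 \<noteq> 0" and F: "F \<in> out_families n"
    and hit: "\<And>i. i \<in> {2..n} \<Longrightarrow> a i = 0 \<Longrightarrow> \<exists>k\<in>{1..n}. i \<in> F k"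
    and "i \<in> {1..n}"
  shows "throughput a F i > 0"
  using assms(4)
proof (induction i rule: less_induct)
  case (less i)
  let ?t = "\<lambda>k. if i \<in> F k then throughput a F k / real (card (F k)) else 0"
  have nonneg: "?t k \<ge> 0" for k by (simp add: throughput_nonneg)
  show ?case
  proof (cases "a i = 0")
    case False
    then show ?thesis
      using sum_nonneg[of "{1..<i}" ?t] nonneg by (subst throughput.simps) auto
  next
    case True
    then have "i \<in> {2..n}" using less.prems assms(1) by (cases "i = 1") auto
    then obtain k where k: "k \<in> {1..n}" "i \<in> F k" using hit True by blast
    then have ki: "k < i" using out_familiesD(1)[OF F k(1)] by auto
    then have "throughput a F k > 0" using less.IH k by auto
    then have "0 < ?t k" using out_familiesD[OF F k(1)] k(2) by (auto simp: card_gt_0_iff)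
    then have "0 < (\<Sum>k\<in>{1..<i}. ?t k)"
      using nonneg k ki by (intro sum_pos2[of _ k]) auto
    then show ?thesis by (subst throughput.simps) simp
  qed
qed

text \<open>Conservation at \<open>i\<close> is the recursion for \<open>throughput\<close>: the
  equal shares on \<open>F i\<close> add up to \<open>throughput a F i\<close>, and the sum in the
  recursion is the inflow.\<close>

lemma even_split_flow:
  fixes n a F
  defines "f \<equiv> \<lambda>(i, j)\<in>parcs (complete_dag (n + 1)).
    if j \<in> F i then throughput a F i / real (card (F i)) else 0"
  assumes F: "F \<in> out_families n"
  shows "f \<in> flow_polytope n a"
proof -
  have "(\<Sum>j\<in>{i<..n + 1}. f (i, j)) - (\<Sum>k\<in>{1..<i}. f (k, i)) = real (a i)" if i: "i \<in> {1..n}" for i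
  proof -
    have "(\<Sum>j\<in>{i<..n + 1}. f (i, j))
        = (\<Sum>j\<in>{i<..n + 1}. if j \<in> F i then throughput a F i / real (card (F i)) else 0)"
      using i by (intro sum.cong) (auto simp: f_def complete_dag_def)
    also have "\<dots> = (\<Sum>j\<in>F i. throughput a F i / real (card (F i)))"
      using out_familiesD[OF F i] by (intro sum.mono_neutral_cong_right) auto
    also have "\<dots> = throughput a F i"
      using out_familiesD[OF F i] by simp
    finally have "(\<Sum>j\<in>{i<..n + 1}. f (i, j)) = throughput a F i" .
    moreover have "(\<Sum>k\<in>{1..<i}. f (k, i))
        = (\<Sum>k\<in>{1..<i}. if i \<in> F k then throughput a F k / real (card (F k)) else 0)"
      using i by (intro sum.cong) (auto simp: f_def complete_dag_def)
    ultimately show ?thesis by (simp add: throughput.simps[of a F i])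
  qed
  moreover have "f \<in> parcs (complete_dag (n + 1)) \<rightarrow>\<^sub>E {0..}"
    by (auto simp: f_def throughput_nonneg)
  ultimately show ?thesis by (auto simp: flow_polytope_def)
qed

text \<open>The even split is the witnessing flow; as every throughput is positive, its support is
  exactly the arc set.\<close>

lemma valid_family_graph:
  assumes "n \<ge> 1" "a 1 \<noteq> 0" and F: "F \<in> out_families n"
    and hit: "\<And>i. i \<in> {2..n} \<Longrightarrow> a i = 0 \<Longrightarrow> \<exists>k\<in>{1..n}. i \<in> F k"
  shows "valid_subgraph n a (family_graph n F)"
  unfolding valid_subgraph_def
proof (intro conjI)
  let ?D = "complete_dag (n + 1)"
  let ?f = "\<lambda>(i, j)\<in>parcs ?D. if j \<in> F i then throughput a F i / real (card (F i)) else 0"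
  have "wf_digraph (with_proj ?D)"
    by unfold_locales (auto simp: complete_dag_def)
  then show "subgraph (with_proj (family_graph n F)) (with_proj ?D)"
    using wf_family_graph[OF F] out_familiesD(1)[OF F]
    by (fastforce simp: subgraph_def family_graph_def complete_dag_def)
  have "throughput a F i / real (card (F i)) > 0" if "i \<in> {1..n}" for i
  proof -
    have "throughput a F i > 0" using assms(2) F hit that by (rule throughput_pos)
    then show ?thesis using out_familiesD[OF F that] by (simp add: card_gt_0_iff)
  qed
  then have "(i, j) \<in> parcs (family_graph n F) \<longleftrightarrow> (i, j) \<in> parcs ?D \<and> ?f (i, j) > 0" for i j
    using out_familiesD(1)[OF F, of i]
    by (cases "i \<in> {1..n} \<and> j \<in> F i") (auto simp: family_graph_def complete_dag_def)
  then have "parcs (family_graph n F) = {e \<in> parcs ?D. ?f e > 0}"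
    by (intro set_eqI) (metis (no_types, lifting) mem_Collect_eq surj_pair)
  then show "\<exists>f\<in>flow_polytope n a. parcs (family_graph n F) = {e \<in> parcs ?D. f e > 0}"
    using even_split_flow[OF F] by blast
  have "{1..n} \<subseteq> Field (Sigma {1..n} F)"
  proof
    fix i assume "i \<in> {1..n}"
    then show "i \<in> Field (Sigma {1..n} F)"
      using out_familiesD(2)[OF F, of i] by (auto simp: Field_def)
  qed
  moreover have "n + 1 \<in> Field (Sigma {1..n} F)"
  proof -
    have n: "n \<in> {1..n}" using \<open>n \<ge> 1\<close> by simp
    \<comment> \<open>The only vertex above \<open>n\<close> is the sink, so the nonempty set
      \<open>F n\<close> is forced and the sink is an endpoint.\<close>
    have "{n<..n + 1} = {n + 1}" by auto
    then have "F n = {n + 1}"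
      using out_familiesD(1,2)[OF F n] by (metis subset_singletonD)
    then have "n + 1 \<in> F n" by simp
    then show ?thesis using n by (intro FieldI2[of n]) simp
  qed
  moreover have "Field (Sigma {1..n} F) \<subseteq> {1..n + 1}"
  proof -
    have "F i \<subseteq> {1..n + 1}" if "i \<in> {1..n}" for i
      using out_familiesD(1)[OF F that] by auto
    then show ?thesis by (force simp: Field_def)
  qed
  moreover have "{1..n + 1} = insert (n + 1) {1..n}" by auto
  ultimately have "{1..n + 1} = Field (Sigma {1..n} F)"
    by (metis insert_subset subset_antisym)
  then show "pverts (family_graph n F) = Field (parcs (family_graph n F))"
    by (simp add: family_graph_def)
qed

lemma valid_spanning_imp_family_graph:
  assumes valid: "valid_subgraph n a H" and verts: "pverts H = {1..n + 1}"
  obtains F where "F \<in> out_families n" "H = family_graph n F"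
    "\<And>i. i \<in> {2..n} \<Longrightarrow> a i = 0 \<Longrightarrow> \<exists>k\<in>{1..n}. i \<in> F k"
proof
  obtain f where f: "f \<in> flow_polytope n a" "parcs H = {e \<in> parcs (complete_dag (n + 1)). f e > 0}"
    and field: "pverts H = Field (parcs H)"
    using valid by (auto simp: valid_subgraph_def)
  have arc: "(i, j) \<in> parcs H \<longleftrightarrow> 1 \<le> i \<and> i < j \<and> j \<le> n + 1 \<and> f (i, j) > 0" for i j
    by (auto simp: f complete_dag_def)
  have nonneg: "f (i, j) \<ge> 0" if "1 \<le> i" "i < j" "j \<le> n + 1" for i j
    using f(1) that by (auto simp: flow_polytope_def complete_dag_def)
  have balance: "(\<Sum>j\<in>{i<..n + 1}. f (i, j)) = real (a i) + (\<Sum>k\<in>{1..<i}. f (k, i))" if "i \<in> {1..n}" for i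
    using f(1) that by (auto simp: flow_polytope_def algebra_simps)
  have out: "\<exists>j. (i, j) \<in> parcs H" if i: "i \<in> {1..n}" for i
  proof (rule ccontr)
    assume no: "\<not> ?thesis"
    \<comment> \<open>Every vertex is an endpoint of an edge, so one that is no tail is a
      head.\<close>
    then obtain k where k: "(k, i) \<in> parcs H"
    proof -
      have "i \<in> pverts H" using i by (simp add: verts)
      then have "i \<in> Field (parcs H)" by (simp only: field)
      then show ?thesis using no that by (auto simp: Field_def)
    qed
    have "0 < (\<Sum>k\<in>{1..<i}. f (k, i))"
      using k i nonneg by (intro sum_pos2[of _ k]) (auto simp: arc)
    also have "\<dots> \<le> (\<Sum>j\<in>{i<..n + 1}. f (i, j))" using balance[OF i] by simp
    also have "\<dots> \<le> 0"
      using no i by (intro sum_nonpos) (auto simp: arc not_less)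
    finally show False by simp
  qed
  \<comment> \<open>Tails are at most \<open>n\<close>, so restricting to \<open>{1..n}\<close>
    loses no arc while making \<open>F\<close> extensional, as \<open>out_families\<close>
    demands.\<close>
  define F where "F = (\<lambda>i\<in>{1..n}. {j. (i, j) \<in> parcs H})"
  show "F \<in> out_families n"
    unfolding out_families_def
  proof (rule PiE_I)
    fix i assume "i \<in> {1..n}"
    then show "F i \<in> Pow {i<..n + 1} - {{}}"
      using out[of i] by (auto simp: F_def) (simp_all add: arc)
  qed (auto simp: F_def)
  have "parcs H = Sigma {1..n} F"
    by (auto simp: F_def arc)
  then show "H = family_graph n F"
    using verts by (simp add: family_graph_def)
  show "\<exists>k\<in>{1..n}. i \<in> F k" if i: "i \<in> {2..n}" "a i = 0" for i
  proof (rule ccontr)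
    assume no: "\<not> ?thesis"
    have i1: "i \<in> {1..n}" using i by auto
    obtain j where j: "(i, j) \<in> parcs H" using out[OF i1] ..
    have "0 < (\<Sum>j\<in>{i<..n + 1}. f (i, j))"
      using j i1 nonneg by (intro sum_pos2[of _ j]) (auto simp: arc)
    also have "\<dots> = (\<Sum>k\<in>{1..<i}. f (k, i))" using balance[OF i1] i(2) by simp
    also have "\<dots> \<le> 0"
    proof (rule sum_nonpos)
      fix k assume k: "k \<in> {1..<i}"
      then have "(k, i) \<notin> parcs H" using no i1 by (auto simp: F_def)
      then show "f (k, i) \<le> 0" using k i1 by (simp add: arc not_less)
    qed
    finally show False by simp
  qed
qed

section \<open>The polynomial as a sum over families\<close>

text \<open>Inclusion-exclusion detects the equality of a set with \<open>{1..n - 1}\<close>, so the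
  condition on incoming edges is brought into that form, with \<open>s\<close> standing for the
  vertex \<open>Suc s\<close>.\<close>

lemma hit_condition:
  "(\<forall>i\<in>{2..n}. a i = 0 \<longrightarrow> (\<exists>k\<in>{1..n}. i \<in> F k)) \<longleftrightarrow>
     supp (n - 1) (\<lambda>j. a (j + 1)) \<union> hit n F = {1..n - 1}" (is "?L \<longleftrightarrow> ?R")
proof -
  have "?L \<longleftrightarrow> (\<forall>s\<in>{1..n - 1}. a (Suc s) = 0 \<longrightarrow> (\<exists>k\<in>{1..n}. Suc s \<in> F k))"
  proof -
    have "{2..n} = Suc ` {1..n - 1}" by (cases n) (auto simp: numeral_2_eq_2)
    then show ?thesis by (simp only: ball_simps)
  qed
  also have "\<dots> \<longleftrightarrow> {1..n - 1} \<subseteq> supp (n - 1) (\<lambda>j. a (j + 1)) \<union> hit n F"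
    by (auto simp: supp_def hit_def subset_iff)
  also have "\<dots> \<longleftrightarrow> ?R"
  proof -
    have "supp (n - 1) (\<lambda>j. a (j + 1)) \<union> hit n F \<subseteq> {1..n - 1}" by (auto simp: supp_def hit_def)
    then show ?thesis by blast
  qed
  finally show ?thesis .
qed

lemma inj_on_family_graph: "inj_on (family_graph n) (out_families n)"
proof
  fix F G assume FG: "F \<in> out_families n" "G \<in> out_families n" "family_graph n F = family_graph n G"
  then have "F i = G i" if "i \<in> {1..n}" for i
    using that by (auto simp: family_graph_def set_eq_iff)
  then show "F = G" using FG(1,2) unfolding out_families_def by (rule PiE_ext[rotated 2])
qed

text \<open>The factor \<open>monom 1 1 ^ n\<close> cancels the \<open>- n\<close> in the Betti
  number: the exponent becomes the number of arcs, which splits over the vertices.\<close>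

lemma primitive_f_poly_out_families:
  assumes "n \<ge> 1" "a 1 \<noteq> 0"
  shows "monom 1 1 ^ n * primitive_f_poly n a =
    (\<Sum>F | F \<in> out_families n \<and> supp (n - 1) (\<lambda>j. a (j + 1)) \<union> hit n F = {1..n - 1}.
      monom 1 1 ^ (\<Sum>i\<in>{1..n}. card (F i)))"
proof -
  let ?A = "{F \<in> out_families n. supp (n - 1) (\<lambda>j. a (j + 1)) \<union> hit n F = {1..n - 1}}"
  have A: "?A = {F \<in> out_families n. \<forall>i\<in>{2..n}. a i = 0 \<longrightarrow> (\<exists>k\<in>{1..n}. i \<in> F k)}"
    by (simp only: hit_condition)
  have "{H. valid_subgraph n a H \<and> primitive n H} = family_graph n ` ?A"
  proof (intro equalityI subsetI)
    fix H assume "H \<in> {H. valid_subgraph n a H \<and> primitive n H}"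
    then have "valid_subgraph n a H" "pverts H = {1..n + 1}" by (auto simp: primitive_def)
    then show "H \<in> family_graph n ` ?A"
      unfolding A by (rule valid_spanning_imp_family_graph) blast
  next
    fix H assume "H \<in> family_graph n ` ?A"
    then obtain F where F: "H = family_graph n F" "F \<in> out_families n"
      "\<And>i. i \<in> {2..n} \<Longrightarrow> a i = 0 \<Longrightarrow> \<exists>k\<in>{1..n}. i \<in> F k"
      unfolding A by blast
    have "valid_subgraph n a H" unfolding F(1) using assms F(2,3) by (rule valid_family_graph)
    moreover have "primitive n H"
      using connected_family_graph[OF F(2)] by (auto simp: primitive_def F(1)) (auto simp: family_graph_def)
    ultimately show "H \<in> {H. valid_subgraph n a H \<and> primitive n H}" by simp
  qed
  then have "primitive_f_poly n a = (\<Sum>F\<in>?A. monom 1 (betti1 (family_graph n F)))"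
    unfolding primitive_f_poly_def
    by (simp add: sum.reindex[OF inj_on_subset[OF inj_on_family_graph]] Collect_mono)
  moreover have "monom 1 1 ^ n * monom 1 (betti1 (family_graph n F))
      = (monom 1 1 :: int poly) ^ (\<Sum>i\<in>{1..n}. card (F i))" if "F \<in> out_families n" for F
    using betti1_family_graph[OF that] by (simp add: monom_power mult_monom add.commute)
  ultimately show ?thesis
    by (simp only: sum_distrib_left) (rule sum.cong, auto)
qed

section \<open>Product formula and inclusion-exclusion\<close>

text \<open>Each factor enumerates the nonempty subsets of a set with \<open>seq S j\<close>
  elements; expanding the product chooses one such subset for every \<open>j\<close>.\<close>

lemma prod_seq_out_families:
  fixes x :: "'a::comm_ring_1"
  assumes S: "S \<subseteq> {1..n - 1}"
  shows "(\<Prod>j\<in>{1..n}. (x + 1) ^ seq S j - 1) =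
    (\<Sum>F | F \<in> out_families n \<and> hit n F \<subseteq> S. x ^ (\<Sum>i\<in>{1..n}. card (F i)))"
proof -
  \<comment> \<open>The targets permitted to \<open>j\<close>: always the sink, which is the
    \<open>1 +\<close> in \<open>seq\<close>, and those \<open>Suc s\<close> with
    \<open>s \<in> S\<close> that lie above \<open>j\<close>, that is \<open>s \<ge> j\<close>. As
    \<open>S\<close> stops at \<open>n - 1\<close>, the sink is not counted twice.\<close>
  define T where "T j = insert (n + 1) (Suc ` {s \<in> S. s \<ge> j})" for j
  have fS: "finite S" using S finite_subset by blast
  have notin: "Suc n \<notin> Suc ` {s \<in> S. s \<ge> j}" for j using S by fastforce
  have card: "seq S j = card (T j)" and fT: "finite (T j)" for j
    using fS notin by (auto simp: seq_def T_def card_image)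
  have T: "k \<in> T j \<longleftrightarrow> k \<in> {j<..n + 1} \<and> (k \<le> n \<longrightarrow> k - 1 \<in> S)" if "j \<in> {1..n}" for j k
    using that S by (cases k) (auto simp: T_def image_iff)
  have "(\<Prod>j\<in>{1..n}. (x + 1) ^ seq S j - 1) = (\<Prod>j\<in>{1..n}. \<Sum>X\<in>Pow (T j) - {{}}. x ^ card X)"
    using fT by (simp add: sum_nonempty_subsets_power_card card)
  also have "\<dots> = (\<Sum>F\<in>(\<Pi>\<^sub>E j\<in>{1..n}. Pow (T j) - {{}}). \<Prod>j\<in>{1..n}. x ^ card (F j))"
    using fT by (intro prod_sum_PiE) auto
  also have "(\<Pi>\<^sub>E j\<in>{1..n}. Pow (T j) - {{}}) = {F \<in> out_families n. hit n F \<subseteq> S}"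
  proof -
    have sub: "(\<forall>j\<in>{1..n}. F j \<subseteq> T j) \<longleftrightarrow> (\<forall>j\<in>{1..n}. F j \<subseteq> {j<..n + 1}) \<and> hit n F \<subseteq> S" for F
    proof (intro iffI conjI)
      assume L: "\<forall>j\<in>{1..n}. F j \<subseteq> T j"
      then show "\<forall>j\<in>{1..n}. F j \<subseteq> {j<..n + 1}" using T by blast
      show "hit n F \<subseteq> S"
      proof
        fix s assume "s \<in> hit n F"
        then obtain j where "j \<in> {1..n}" "Suc s \<in> F j" "s \<in> {1..n - 1}" by (auto simp: hit_def)
        then show "s \<in> S" using L T[of j "Suc s"] by auto
      qed
    next
      assume R: "(\<forall>j\<in>{1..n}. F j \<subseteq> {j<..n + 1}) \<and> hit n F \<subseteq> S"
      show "\<forall>j\<in>{1..n}. F j \<subseteq> T j"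
      proof (intro ballI subsetI)
        fix j k assume jk: "j \<in> {1..n}" "k \<in> F j"
        then have k: "k \<in> {j<..n + 1}" using R by blast
        moreover have "k - 1 \<in> S" if "k \<le> n"
        proof -
          \<comment> \<open>From \<open>k > j\<close> and \<open>j \<ge> 1\<close>, the index
            \<open>k - 1\<close> is at least 1, as \<open>hit\<close> requires.\<close>
          have "Suc (k - 1) \<in> F j" "k - 1 \<in> {1..n - 1}" using jk k that by auto
          then have "k - 1 \<in> hit n F" using jk(1) unfolding hit_def by blast
          then show ?thesis using R by blast
        qed
        ultimately show "k \<in> T j" using T jk(1) by blast
      qed
    qed
    have mem: "F \<in> (\<Pi>\<^sub>E j\<in>{1..n}. Pow (Q j) - {{}}) \<longleftrightarrow>
        (\<forall>j\<in>{1..n}. F j \<subseteq> Q j) \<and> (\<forall>j\<in>{1..n}. F j \<noteq> {}) \<and> F \<in> extensional {1..n}" for F Q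
      unfolding PiE_iff by auto
    show ?thesis
      unfolding out_families_def set_eq_iff mem_Collect_eq mem sub by blast
  qed
  finally show ?thesis by (simp add: power_sum)
qed

theorem lemma3p5:
  fixes n :: nat and a :: "nat \<Rightarrow> nat"
  assumes "n \<ge> 1" and "a 1 \<noteq> 0"
  defines "x \<equiv> monom 1 1 :: int poly"
  shows "Fract (primitive_f_poly n a) 1 =
    Fract 1 (x ^ n) *
    Fract (\<Sum>S | supp (n - 1) (\<lambda>j. a (j + 1)) \<subseteq> S \<and> S \<subseteq> {1..n - 1}.
      (- 1) ^ (card S + n + 1) * (\<Prod>j\<in>{1..n}. (x + 1) ^ seq S j - 1)) 1"
proof -
  let ?B = "{1..n - 1}"
  let ?A = "supp (n - 1) (\<lambda>j. a (j + 1))"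
  let ?Ss = "{S. ?A \<subseteq> S \<and> S \<subseteq> ?B}"
  let ?w = "\<lambda>F. x ^ (\<Sum>i\<in>{1..n}. card (F i))"
  have A: "?A \<subseteq> ?B" by (auto simp: supp_def)
  have hit: "hit n F \<subseteq> ?B" for F by (auto simp: hit_def)
  \<comment> \<open>For \<open>n \<ge> 1\<close>, \<open>card ?B\<close> is \<open>n - 1\<close>, of
    the same parity as \<open>n + 1\<close>.\<close>
  have sgn: "(- 1 :: int poly) ^ (k + n + 1) = (- 1) ^ (k + card ?B)" for k
    using \<open>n \<ge> 1\<close> by (cases n) auto
  have "(\<Sum>S\<in>?Ss. (- 1) ^ (card S + n + 1) * (\<Prod>j\<in>{1..n}. (x + 1) ^ seq S j - 1))
      = (\<Sum>S\<in>?Ss. \<Sum>F | F \<in> out_families n \<and> hit n F \<subseteq> S. (- 1) ^ (card S + card ?B) * ?w F)"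
  proof (intro sum.cong refl)
    fix S assume "S \<in> ?Ss"
    then have "S \<subseteq> ?B" by simp
    then show "(- 1) ^ (card S + n + 1) * (\<Prod>j\<in>{1..n}. (x + 1) ^ seq S j - 1)
        = (\<Sum>F | F \<in> out_families n \<and> hit n F \<subseteq> S. (- 1) ^ (card S + card ?B) * ?w F)"
      by (simp only: prod_seq_out_families sgn sum_distrib_left)
  qed
  also have "\<dots> = (\<Sum>F\<in>out_families n. \<Sum>S | S \<in> ?Ss \<and> hit n F \<subseteq> S. (- 1) ^ (card S + card ?B) * ?w F)"
    by (intro sum.swap_restrict finite_out_families) auto
  \<comment> \<open>For a fixed family, \<open>S\<close> runs over the interval from
    \<open>?A \<union> hit n F\<close> to \<open>?B\<close>, whose signed sum vanishes unless both
    ends agree.\<close>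
  also have "\<dots> = (\<Sum>F\<in>out_families n. (if ?A \<union> hit n F = ?B then 1 else 0) * ?w F)"
  proof (intro sum.cong refl)
    fix F
    have "{S. S \<in> ?Ss \<and> hit n F \<subseteq> S} = {S. ?A \<union> hit n F \<subseteq> S \<and> S \<subseteq> ?B}" by auto
    moreover have "(\<Sum>S | ?A \<union> hit n F \<subseteq> S \<and> S \<subseteq> ?B. (- 1 :: int poly) ^ (card S + card ?B))
        = (if ?A \<union> hit n F = ?B then 1 else 0)"
      using A hit by (intro sum_interval_alternating) auto
    ultimately show "(\<Sum>S | S \<in> ?Ss \<and> hit n F \<subseteq> S. (- 1) ^ (card S + card ?B) * ?w F)
        = (if ?A \<union> hit n F = ?B then 1 else 0) * ?w F"
      by (simp only: flip: sum_distrib_right)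
  qed
  also have "\<dots> = (\<Sum>F | F \<in> out_families n \<and> ?A \<union> hit n F = ?B. ?w F)"
    using finite_out_families by (intro sum.mono_neutral_cong_right) auto
  also have "\<dots> = x ^ n * primitive_f_poly n a"
    unfolding x_def using assms(1,2) by (rule primitive_f_poly_out_families[symmetric])
  finally have "(\<Sum>S\<in>?Ss. (- 1) ^ (card S + n + 1) * (\<Prod>j\<in>{1..n}. (x + 1) ^ seq S j - 1))
      = x ^ n * primitive_f_poly n a" .
  \<comment> \<open>With nonzero denominators, cross-multiplication reduces the identity of
    fractions to the polynomial identity just obtained.\<close>
  moreover have "x ^ n \<noteq> 0" by (simp add: x_def)
  ultimately show ?thesis by (simp add: eq_fract)
qed

end
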